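(* Let $n\ge 2$ and let $m_1<\cdots<m_n$ be an arithmetic sequence of positive integers, i.e. $m_i=m_1+(i-1)d$ for all $i\in\{1,\ldots,n\}$ with $d\in\mathbb{Z}^+$, and suppose $\gcd\{m_1,d\}=1$. Let $q\in\mathbb{N}$ and $r\in\{1,\ldots,n-1\}$ be such that $m_1=q(n-1)+r$, and set $\alpha:=q+d$ and $k:=n-r$. Then $$\mathcal{G}=\{x_ix_j-x_{i-1}x_{j+1}\mid 2\le i\le j\le n-1\}\cup\{x_1^{\alpha}x_i-x_{n-k+i}\,x_n^{q}\,x_{n+1}^{d}\mid 1\le i\le k\}$$ is a minimal Gröbner basis of $I(\mathcal{C})$ with respect to the degree reverse lexicographic order with $x_1>\cdots>x_{n+1}$.
   Context: $K$ is an infinite field, $R=K[x_1,\ldots,x_{n+1}]$, and $0\in\mathbb{N}$. For positive integers $m_1<\cdots<m_n$, the associated projective monomial curve $\mathcal{C}\subset\mathbb{P}^n_K$ is parametrically defined by $x_i=u^{m_i}v^{m_n-m_i}$ for $1\le i\le n$ (so $x_n=u^{m_n}$) and $x_{n+1}=v^{m_n}$. Its vanishing ideal $I(\mathcal{C})\subset R$ is the kernel of the $K$-algebra homomorphism $R\to K[u,v]$, $x_i\mapsto u^{m_i}v^{m_n-m_i}$ ($1\le i\le n$), $x_{n+1}\mapsto v^{m_n}$. A Gröbner basis is minimal if its elements have leading coefficient $1$ and no leading monomial of one of its elements divides the leading monomial of another. *)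

theory Defs
  imports "HOL-Library.Poly_Mapping" "HOL-Algebra.RingHom"
begin

text \<open>
  A monomial is an exponent vector with finite support (so the product of monomials is
  \<open>+\<close> of exponent vectors), a polynomial a finitely supported coefficient function on monomials,
  multiplied by the convolution product of \<^theory>\<open>HOL-Library.Poly_Mapping\<close>.
\<close>

type_synonym 'v monomial = "'v \<Rightarrow>\<^sub>0 nat"
type_synonym ('v, 'a) polynomial = "'v monomial \<Rightarrow>\<^sub>0 'a"

definition monomial_poly :: "'v monomial \<Rightarrow> ('v, 'a::comm_ring_1) polynomial" where
  "monomial_poly t = Poly_Mapping.single t 1"

definition const :: "'a::comm_ring_1 \<Rightarrow> ('v, 'a) polynomial" where
  "const c = Poly_Mapping.single 0 c"

definition var :: "'v \<Rightarrow> ('v, 'a::comm_ring_1) polynomial" where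
  "var i = monomial_poly (Poly_Mapping.single i 1)"

text \<open>\<open>polynomial_ring V\<close> is the ring of polynomials in the variables indexed by \<open>V\<close>.\<close>

definition polynomial_ring :: "'v set \<Rightarrow> ('v, 'a::comm_ring_1) polynomial ring" where
  "polynomial_ring V =
     \<lparr>carrier = {p. \<forall>t \<in> Poly_Mapping.keys p. Poly_Mapping.keys t \<subseteq> V},
      monoid.mult = (*), one = 1, zero = 0, add = (+)\<rparr>"

text \<open>\<open>poly_subst f\<close> is the algebra homomorphism sending each \<open>var i\<close> to \<open>f i\<close>;
  see \<open>poly_subst_ring_hom\<close>, \<open>poly_subst_const\<close>, \<open>poly_subst_var\<close> below.\<close>

definition poly_subst ::
  "('v \<Rightarrow> ('w, 'a::comm_ring_1) polynomial) \<Rightarrow> ('v, 'a) polynomial \<Rightarrow> ('w, 'a) polynomial" where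
  "poly_subst f p =
     (\<Sum>t \<in> Poly_Mapping.keys p. const (Poly_Mapping.lookup p t) *
        (\<Prod>i \<in> Poly_Mapping.keys t. f i ^ Poly_Mapping.lookup t i))"

text \<open>A monomial order is passed as its strict part: \<open>ord s t\<close> means that \<open>s\<close> is smaller than \<open>t\<close>.
  The leading monomial and leading coefficient are only meaningful for \<open>p \<noteq> 0\<close>.\<close>

definition lead_monomial ::
  "('v monomial \<Rightarrow> 'v monomial \<Rightarrow> bool) \<Rightarrow> ('v, 'a::comm_ring_1) polynomial \<Rightarrow> 'v monomial" where
  "lead_monomial ord p =
     (THE t. t \<in> Poly_Mapping.keys p \<and> (\<forall>s \<in> Poly_Mapping.keys p. s \<noteq> t \<longrightarrow> ord s t))"

definition lead_coefficient ::
  "('v monomial \<Rightarrow> 'v monomial \<Rightarrow> bool) \<Rightarrow> ('v, 'a::comm_ring_1) polynomial \<Rightarrow> 'a" where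
  "lead_coefficient ord p = Poly_Mapping.lookup p (lead_monomial ord p)"

definition total_degree :: "'v monomial \<Rightarrow> nat" where
  "total_degree t = (\<Sum>i \<in> Poly_Mapping.keys t. Poly_Mapping.lookup t i)"

text \<open>Variables with smaller index are larger: with equal total degrees, \<open>s\<close> is smaller than \<open>t\<close>
  iff at the last index where they differ, the exponent in \<open>s\<close> is the larger one.\<close>

definition degrevlex :: "nat monomial \<Rightarrow> nat monomial \<Rightarrow> bool" where
  "degrevlex s t \<longleftrightarrow>
     total_degree s < total_degree t \<or>
     total_degree s = total_degree t \<and>
       (\<exists>i. Poly_Mapping.lookup s i > Poly_Mapping.lookup t i \<and>
            (\<forall>j > i. Poly_Mapping.lookup s j = Poly_Mapping.lookup t j))"

definition initial_ideal ::
  "'v set \<Rightarrow> ('v monomial \<Rightarrow> 'v monomial \<Rightarrow> bool) \<Rightarrow>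
     ('v, 'a::comm_ring_1) polynomial set \<Rightarrow> ('v, 'a) polynomial set" where
  "initial_ideal V ord S =
     genideal (polynomial_ring V) ((\<lambda>p. monomial_poly (lead_monomial ord p)) ` (S - {0}))"

definition groebner_basis ::
  "'v set \<Rightarrow> ('v monomial \<Rightarrow> 'v monomial \<Rightarrow> bool) \<Rightarrow>
     ('v, 'a::comm_ring_1) polynomial set \<Rightarrow> ('v, 'a) polynomial set \<Rightarrow> bool" where
  "groebner_basis V ord I G \<longleftrightarrow>
     finite G \<and> G \<subseteq> I \<and> initial_ideal V ord G = initial_ideal V ord I"

text \<open>The condition on leading coefficients excludes \<open>0 \<in> G\<close>.\<close>

definition minimal_groebner_basis ::
  "'v set \<Rightarrow> ('v monomial \<Rightarrow> 'v monomial \<Rightarrow> bool) \<Rightarrow>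
     ('v, 'a::comm_ring_1) polynomial set \<Rightarrow> ('v, 'a) polynomial set \<Rightarrow> bool" where
  "minimal_groebner_basis V ord I G \<longleftrightarrow>
     groebner_basis V ord I G \<and>
     (\<forall>g \<in> G. lead_coefficient ord g = 1) \<and>
     (\<forall>g \<in> G. \<forall>h \<in> G. g \<noteq> h \<longrightarrow>
        \<not> (\<exists>t. lead_monomial ord h = lead_monomial ord g + t))"

text \<open>The variables \<open>u, v\<close> of the parametrization, and the ideal of the projective monomial curve:
  the kernel of the parametrization homomorphism \<open>K[x\<^sub>1, \<dots>, x\<^sub>n\<^sub>+\<^sub>1] \<rightarrow> K[u, v]\<close>.\<close>

datatype param = Par_u | Par_v

definition curve_param :: "nat \<Rightarrow> (nat \<Rightarrow> nat) \<Rightarrow> nat \<Rightarrow> (param, 'a::comm_ring_1) polynomial" where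
  "curve_param n m i =
     (if i = n + 1 then var Par_v ^ m n else var Par_u ^ m i * var Par_v ^ (m n - m i))"

definition curve_ideal :: "nat \<Rightarrow> (nat \<Rightarrow> nat) \<Rightarrow> (nat, 'a::comm_ring_1) polynomial set" where
  "curve_ideal n m =
     a_kernel (polynomial_ring {1..n + 1}) (polynomial_ring UNIV) (poly_subst (curve_param n m))"

lemma polynomial_ring_sel [simp]:
  "p \<otimes>\<^bsub>polynomial_ring V\<^esub> q = p * q" "p \<oplus>\<^bsub>polynomial_ring V\<^esub> q = p + q"
  "\<one>\<^bsub>polynomial_ring V\<^esub> = 1" "\<zero>\<^bsub>polynomial_ring V\<^esub> = 0"
  by (simp_all add: polynomial_ring_def)

lemma carrier_polynomial_ring:
  "p \<in> carrier (polynomial_ring V) \<longleftrightarrow>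
     (\<forall>t \<in> Poly_Mapping.keys p. Poly_Mapping.keys t \<subseteq> V)"
  by (simp add: polynomial_ring_def)

lemma cring_polynomial_ring: "cring (polynomial_ring V :: ('v, 'a::comm_ring_1) polynomial ring)"
proof (rule cringI)
  let ?R = "polynomial_ring V :: ('v, 'a) polynomial ring"
  have neg: "- p \<in> carrier ?R" if "p \<in> carrier ?R" for p
    using that by (simp add: carrier_polynomial_ring)
  have add: "p + q \<in> carrier ?R" if "p \<in> carrier ?R" "q \<in> carrier ?R" for p q
    using that Poly_Mapping.keys_add[of p q] unfolding carrier_polynomial_ring by blast
  have mult: "p * q \<in> carrier ?R" if pq: "p \<in> carrier ?R" "q \<in> carrier ?R" for p q
    unfolding carrier_polynomial_ring
  proof
    fix t assume "t \<in> Poly_Mapping.keys (p * q)"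
    then obtain a b where t: "t = a + b" "a \<in> Poly_Mapping.keys p" "b \<in> Poly_Mapping.keys q"
      using keys_mult[of p q] by blast
    hence "Poly_Mapping.keys a \<subseteq> V" "Poly_Mapping.keys b \<subseteq> V"
      using pq by (simp_all add: carrier_polynomial_ring)
    thus "Poly_Mapping.keys t \<subseteq> V"
      using Poly_Mapping.keys_add[of a b] t(1) by blast
  qed
  have zero_one: "0 \<in> carrier ?R" "1 \<in> carrier ?R"
    by (simp_all add: carrier_polynomial_ring)
  show "abelian_group ?R"
  proof (rule abelian_groupI)
    fix p assume "p \<in> carrier ?R"
    thus "\<exists>q \<in> carrier ?R. q \<oplus>\<^bsub>?R\<^esub> p = \<zero>\<^bsub>?R\<^esub>"
      using neg[of p] by (intro bexI[of _ "- p"]) simp_all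
  qed (simp_all add: add zero_one add_ac)
  show "Group.comm_monoid ?R"
    by (rule Group.comm_monoidI) (simp_all add: mult zero_one mult_ac)
qed (simp add: distrib_right)

lemma poly_subst_superset:
  assumes "finite A" "Poly_Mapping.keys p \<subseteq> A"
  shows "poly_subst f p = (\<Sum>t \<in> A. const (Poly_Mapping.lookup p t) *
        (\<Prod>i \<in> Poly_Mapping.keys t. f i ^ Poly_Mapping.lookup t i))"
  unfolding poly_subst_def
  by (rule sum.mono_neutral_left) (use assms in \<open>auto simp: const_def in_keys_iff\<close>)

lemma poly_subst_add: "poly_subst f (p + q) = poly_subst f p + poly_subst f q"
proof -
  let ?A = "Poly_Mapping.keys p \<union> Poly_Mapping.keys q"
  have "Poly_Mapping.keys (p + q) \<subseteq> ?A" by (rule Poly_Mapping.keys_add)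
  thus ?thesis
    by (simp add: poly_subst_superset[of ?A] lookup_add const_def single_add distrib_right
        sum.distrib)
qed

lemma poly_subst_single: "poly_subst f (Poly_Mapping.single t c) =
    const c * (\<Prod>i \<in> Poly_Mapping.keys t. f i ^ Poly_Mapping.lookup t i)"
  by (subst poly_subst_superset[of "{t}"]) auto

lemma poly_subst_const: "poly_subst f (const c) = const c"
  by (simp add: const_def poly_subst_single)

lemma poly_subst_var: "poly_subst f (var i) = f i"
  by (simp add: var_def monomial_poly_def poly_subst_single const_def)

lemma monomial_subst_add:
  fixes f :: "'v \<Rightarrow> 'b::comm_monoid_mult"
  shows "(\<Prod>i \<in> Poly_Mapping.keys (s + t). f i ^ Poly_Mapping.lookup (s + t) i) =
    (\<Prod>i \<in> Poly_Mapping.keys s. f i ^ Poly_Mapping.lookup s i) *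
    (\<Prod>i \<in> Poly_Mapping.keys t. f i ^ Poly_Mapping.lookup t i)"
proof -
  let ?A = "Poly_Mapping.keys s \<union> Poly_Mapping.keys t"
  have *: "(\<Prod>i \<in> Poly_Mapping.keys r. f i ^ Poly_Mapping.lookup r i) =
      (\<Prod>i \<in> ?A. f i ^ Poly_Mapping.lookup r i)" if "Poly_Mapping.keys r \<subseteq> ?A" for r
    by (rule prod.mono_neutral_left) (use that in \<open>auto simp: in_keys_iff\<close>)
  show ?thesis
    unfolding *[OF Poly_Mapping.keys_add] *[OF Un_upper1] *[OF Un_upper2]
    by (simp add: lookup_add power_add prod.distrib)
qed

lemma polynomial_induct [case_names zero add]:
  assumes "P 0" "\<And>t c p. P p \<Longrightarrow> P (Poly_Mapping.single t c + p)"
  shows "P (p :: ('v, 'a::comm_ring_1) polynomial)"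
proof -
  let ?mon = "\<lambda>t. Poly_Mapping.single t (Poly_Mapping.lookup p t)"
  have "P (sum ?mon A)" if "finite A" for A
    using that by induction (simp_all add: assms)
  moreover have "sum ?mon (Poly_Mapping.keys p) = p"
    by (rule poly_mapping_eqI)
      (simp add: lookup_sum lookup_single when_def in_keys_iff sum.delta)
  ultimately show ?thesis
    using finite_keys[of p] by metis
qed

lemma const_mult: "const (a * b) = const a * const b"
  by (simp add: const_def mult_single)

lemma poly_subst_mult: "poly_subst f (p * q) = poly_subst f p * poly_subst f q"
proof -
  have zero: "poly_subst f 0 = 0" by (simp add: poly_subst_def)
  have *: "poly_subst f (Poly_Mapping.single s c * q) =
      poly_subst f (Poly_Mapping.single s c) * poly_subst f q" for s c
    by (induction q rule: polynomial_induct)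
      (simp_all add: zero distrib_left poly_subst_add mult_single poly_subst_single
        monomial_subst_add const_mult mult_ac)
  show ?thesis
    by (induction p rule: polynomial_induct) (simp_all add: zero distrib_right poly_subst_add *)
qed

lemma poly_subst_ring_hom:
  "poly_subst f \<in> ring_hom (polynomial_ring V) (polynomial_ring UNIV)"
proof (rule ring_hom_memI)
  have "poly_subst f 1 = 1"
    using poly_subst_const[of f 1] by (simp add: const_def)
  thus "poly_subst f \<one>\<^bsub>polynomial_ring V\<^esub> = \<one>\<^bsub>polynomial_ring UNIV\<^esub>"
    by simp
qed (simp_all add: carrier_polynomial_ring poly_subst_add poly_subst_mult)

end

theory Submission
  imports Defs
begin

text \<open>
  Call a monomial normal if no leading monomial of the binomials in \<open>\<G>\<close> divides it. The
  parametrization maps monomials to monomials, and the binomials in \<open>\<G>\<close> rewrite a monomial to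
  a smaller one with the same image, so the least monomial of every fibre is normal. A direct
  computation with exponents shows that each fibre contains only one normal monomial. Hence a
  normal monomial is the least one in its fibre. But the leading monomial of a nonzero \<open>p \<in> I(\<C>)\<close>
  is not, because its image must cancel against that of a smaller monomial of \<open>p\<close>. So it is divisible by a
  leading monomial of \<open>\<G>\<close>.
\<close>

section \<open>Total degree and the degree reverse lexicographic order\<close>

lemma total_degree_superset:
  assumes "finite A" "Poly_Mapping.keys t \<subseteq> A"
  shows "total_degree t = (\<Sum>i\<in>A. Poly_Mapping.lookup t i)"
  unfolding total_degree_def
  by (rule sum.mono_neutral_left) (use assms in \<open>auto simp: in_keys_iff\<close>)

lemma total_degree_add: "total_degree (s + t) = total_degree s + total_degree t"
proof -
  let ?A = "Poly_Mapping.keys s \<union> Poly_Mapping.keys t"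
  have "Poly_Mapping.keys (s + t) \<subseteq> ?A" by (rule Poly_Mapping.keys_add)
  thus ?thesis
    by (simp add: total_degree_superset[of ?A] lookup_add sum.distrib)
qed

lemma total_degree_single: "total_degree (Poly_Mapping.single i a) = a"
  by (simp add: total_degree_superset[of "{i}"])

text \<open>A degree bound also bounds every exponent, which leaves finitely many functions on
  \<open>V\<close>. As \<open>degrevlex\<close> compares degrees first, least monomials of fibres
  then exist without a separate proof of well-foundedness.\<close>

lemma finite_monomials_bounded_degree:
  assumes "finite V"
  shows "finite {t :: 'v monomial. Poly_Mapping.keys t \<subseteq> V \<and> total_degree t \<le> D}"
proof -
  let ?S = "{t :: 'v monomial. Poly_Mapping.keys t \<subseteq> V \<and> total_degree t \<le> D}"
  have "Poly_Mapping.lookup t i \<le> D" if "t \<in> ?S" "i \<in> V" for t i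
  proof -
    have "Poly_Mapping.lookup t i \<le> (\<Sum>i\<in>V. Poly_Mapping.lookup t i)"
      using that assms by (intro member_le_sum) auto
    also have "\<dots> = total_degree t"
      using that assms by (simp add: total_degree_superset)
    also have "\<dots> \<le> D" using that by simp
    finally show ?thesis .
  qed
  hence "Poly_Mapping.lookup ` ?S \<subseteq>
      {f. \<forall>i. (i \<in> V \<longrightarrow> f i \<in> {..D}) \<and> (i \<notin> V \<longrightarrow> f i = 0)}"
    by (auto simp: in_keys_iff)
  moreover have "finite {f. \<forall>i. (i \<in> V \<longrightarrow> f i \<in> {..D}) \<and> (i \<notin> V \<longrightarrow> f i = (0::nat))}"
    by (rule finite_set_of_finite_funs) (use assms in auto)
  ultimately have "finite (Poly_Mapping.lookup ` ?S)" by (rule finite_subset)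
  thus ?thesis by (rule finite_imageD) (simp add: inj_on_def)
qed

lemma degrevlex_irrefl: "\<not> degrevlex t t"
  by (simp add: degrevlex_def)

lemma degrevlex_trans:
  assumes "degrevlex s t" "degrevlex t u"
  shows "degrevlex s u"
proof (cases "total_degree s < total_degree u")
  case False
  with assms have eq: "total_degree s = total_degree t" "total_degree t = total_degree u"
    by (auto simp: degrevlex_def)
  with assms obtain i j where
    i: "Poly_Mapping.lookup s i > Poly_Mapping.lookup t i"
       "\<forall>l>i. Poly_Mapping.lookup s l = Poly_Mapping.lookup t l" and
    j: "Poly_Mapping.lookup t j > Poly_Mapping.lookup u j"
       "\<forall>l>j. Poly_Mapping.lookup t l = Poly_Mapping.lookup u l"
    by (auto simp: degrevlex_def)
  \<comment> \<open>At the later of the two witnesses one comparison is strict and the other is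
    strict or an equality.\<close>
  have "Poly_Mapping.lookup s (max i j) > Poly_Mapping.lookup u (max i j)"
    using i j by (cases i j rule: linorder_cases) (auto simp: max_def)
  moreover have "\<forall>l>max i j. Poly_Mapping.lookup s l = Poly_Mapping.lookup u l"
    using i j by simp
  ultimately show ?thesis using eq by (auto simp: degrevlex_def)
qed (simp add: degrevlex_def)

lemma degrevlex_total:
  assumes "s \<noteq> t"
  shows "degrevlex s t \<or> degrevlex t s"
proof (cases "total_degree s" "total_degree t" rule: linorder_cases)
  case equal
  \<comment> \<open>Finite because both supports are; its maximum is the index that decides the
    comparison.\<close>
  define D where "D = {i. Poly_Mapping.lookup s i \<noteq> Poly_Mapping.lookup t i}"
  have "D \<subseteq> Poly_Mapping.keys s \<union> Poly_Mapping.keys t"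
    by (auto simp: D_def in_keys_iff)
  hence fin: "finite D" by (rule finite_subset) simp
  have "D \<noteq> {}"
  proof
    assume "D = {}"
    hence "s = t" by (intro poly_mapping_eqI) (simp add: D_def)
    thus False using assms by simp
  qed
  hence "Max D \<in> D" using fin by (intro Max_in)
  moreover have "j \<notin> D" if "j > Max D" for j
    using Max_ge[OF fin, of j] that by (auto simp del: Max_ge)
  ultimately have D: "Poly_Mapping.lookup s (Max D) \<noteq> Poly_Mapping.lookup t (Max D)"
    "\<forall>j>Max D. Poly_Mapping.lookup s j = Poly_Mapping.lookup t j"
    unfolding D_def by blast+
  from D(1) show ?thesis
  proof (rule linorder_neqE_nat)
    assume "Poly_Mapping.lookup s (Max D) < Poly_Mapping.lookup t (Max D)"
    hence "degrevlex t s"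
      unfolding degrevlex_def using equal D(2) by (intro disjI2 conjI exI[of _ "Max D"]) simp_all
    thus ?thesis ..
  next
    assume "Poly_Mapping.lookup t (Max D) < Poly_Mapping.lookup s (Max D)"
    hence "degrevlex s t"
      unfolding degrevlex_def using equal D(2) by (intro disjI2 conjI exI[of _ "Max D"]) simp_all
    thus ?thesis ..
  qed
qed (simp_all add: degrevlex_def)

lemma degrevlex_asym: "degrevlex s t \<Longrightarrow> \<not> degrevlex t s"
  using degrevlex_irrefl degrevlex_trans[of s t s] by blast

lemma asymp_on_degrevlex: "asymp_on A degrevlex"
  by (rule asymp_onI) (rule degrevlex_asym)

lemma transp_on_degrevlex: "transp_on A degrevlex"
  by (rule transp_onI) (rule degrevlex_trans)

lemma degrevlex_add_right: "degrevlex s t \<Longrightarrow> degrevlex (s + u) (t + u)"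
  by (auto simp: degrevlex_def total_degree_add lookup_add)

lemma lead_monomial_eqI:
  assumes "t \<in> Poly_Mapping.keys p" "\<And>s. s \<in> Poly_Mapping.keys p \<Longrightarrow> s \<noteq> t \<Longrightarrow> degrevlex s t"
  shows "lead_monomial degrevlex p = t"
  unfolding lead_monomial_def
proof (rule the_equality)
  show "t \<in> Poly_Mapping.keys p \<and> (\<forall>s \<in> Poly_Mapping.keys p. s \<noteq> t \<longrightarrow> degrevlex s t)"
    using assms by simp
  fix u assume u: "u \<in> Poly_Mapping.keys p \<and> (\<forall>s \<in> Poly_Mapping.keys p. s \<noteq> u \<longrightarrow> degrevlex s u)"
  show "u = t"
  proof (rule ccontr)
    assume "u \<noteq> t"
    with u assms(1) have "degrevlex t u" by simp
    moreover have "degrevlex u t" using u \<open>u \<noteq> t\<close> by (intro assms(2)) simp_all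
    ultimately show False by (simp add: degrevlex_asym)
  qed
qed

text \<open>A maximal element of the finite nonempty support is greatest because the order is total,
  so the \<open>THE\<close> in \<open>lead_monomial\<close> denotes it.\<close>

lemma lead_monomial_greatest:
  assumes "p \<noteq> 0"
  shows "lead_monomial degrevlex p \<in> Poly_Mapping.keys p"
    and "\<And>s. s \<in> Poly_Mapping.keys p \<Longrightarrow> s \<noteq> lead_monomial degrevlex p \<Longrightarrow>
      degrevlex s (lead_monomial degrevlex p)"
proof -
  have "\<exists>t \<in> Poly_Mapping.keys p. \<forall>s \<in> Poly_Mapping.keys p. s \<noteq> t \<longrightarrow> \<not> degrevlex t s"
    by (rule Finite_Set.bex_max_element[OF finite_keys asymp_on_degrevlex transp_on_degrevlex])
      (use assms in simp)
  then obtain t where tp: "t \<in> Poly_Mapping.keys p"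
    and max: "\<forall>s \<in> Poly_Mapping.keys p. s \<noteq> t \<longrightarrow> \<not> degrevlex t s"
    by blast
  have t: "t \<in> Poly_Mapping.keys p"
    "\<And>s. s \<in> Poly_Mapping.keys p \<Longrightarrow> s \<noteq> t \<Longrightarrow> degrevlex s t"
    using tp max degrevlex_total by metis+
  have lm: "lead_monomial degrevlex p = t" using t by (rule lead_monomial_eqI)
  show "lead_monomial degrevlex p \<in> Poly_Mapping.keys p"
    unfolding lm by (rule t(1))
  show "\<And>s. s \<in> Poly_Mapping.keys p \<Longrightarrow> s \<noteq> lead_monomial degrevlex p \<Longrightarrow>
      degrevlex s (lead_monomial degrevlex p)"
    unfolding lm by (rule t(2))
qed

section \<open>Monomials and binomials as polynomials\<close>

lemma monomial_poly_add: "monomial_poly (s + t) = monomial_poly s * monomial_poly t"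
  by (simp add: monomial_poly_def mult_single)

lemma monomial_poly_0: "monomial_poly 0 = 1"
  by (simp add: monomial_poly_def)

lemma monomial_poly_sum: "monomial_poly (\<Sum>i\<in>A. g i) = (\<Prod>i\<in>A. monomial_poly (g i))"
  by (induction A rule: infinite_finite_induct) (simp_all add: monomial_poly_add monomial_poly_0)

lemma var_power: "var i ^ k = monomial_poly (Poly_Mapping.single i k)"
proof (induction k)
  case (Suc k)
  have "Poly_Mapping.single i (Suc k) = Poly_Mapping.single i 1 + Poly_Mapping.single i k"
    by (simp add: single_add[symmetric])
  thus ?case using Suc by (simp add: monomial_poly_add var_def)
qed (simp add: monomial_poly_0)

text \<open>Irreflexivity keeps the two terms from cancelling, so the larger one survives with
  coefficient 1.\<close>

lemma
  fixes l t :: "nat monomial"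
  assumes "degrevlex t l"
  defines "p \<equiv> monomial_poly l - monomial_poly t :: (nat, 'a::comm_ring_1) polynomial"
  shows lead_monomial_binomial: "lead_monomial degrevlex p = l"
    and lead_coefficient_binomial: "lead_coefficient degrevlex p = 1"
proof -
  have "t \<noteq> l" using assms(1) degrevlex_irrefl by blast
  hence lk: "Poly_Mapping.lookup p l = 1"
    by (simp add: p_def monomial_poly_def lookup_minus lookup_single)
  have "Poly_Mapping.keys p \<subseteq> {l, t}"
    by (auto simp: p_def monomial_poly_def in_keys_iff lookup_minus lookup_single when_def
        split: if_splits)
  thus lm: "lead_monomial degrevlex p = l"
    using assms(1) lk by (intro lead_monomial_eqI) (auto simp: in_keys_iff)
  show "lead_coefficient degrevlex p = 1"
    by (simp add: lead_coefficient_def lm lk)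
qed

lemma monomial_poly_carrier:
  "Poly_Mapping.keys t \<subseteq> V \<Longrightarrow> monomial_poly t \<in> carrier (polynomial_ring V)"
  by (simp add: carrier_polynomial_ring monomial_poly_def)

text \<open>A substitution that maps monomials to monomials turns coefficients into fibre sums. For
  \<open>p\<close> in the kernel all these sums vanish, so no monomial of \<open>p\<close> is alone
  in its fibre.\<close>

lemma lookup_poly_subst:
  assumes "\<And>t. t \<in> Poly_Mapping.keys p \<Longrightarrow> poly_subst f (monomial_poly t) = monomial_poly (\<phi> t)"
  shows "Poly_Mapping.lookup (poly_subst f p) w =
    (\<Sum>t | t \<in> Poly_Mapping.keys p \<and> \<phi> t = w. Poly_Mapping.lookup p t)"
proof -
  have "poly_subst f p =
      (\<Sum>t\<in>Poly_Mapping.keys p. Poly_Mapping.single (\<phi> t) (Poly_Mapping.lookup p t))"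
    unfolding poly_subst_def
  proof (rule sum.cong)
    fix t assume "t \<in> Poly_Mapping.keys p"
    with assms have "(\<Prod>i\<in>Poly_Mapping.keys t. f i ^ Poly_Mapping.lookup t i) = monomial_poly (\<phi> t)"
      by (simp add: poly_subst_single monomial_poly_def const_def)
    thus "const (Poly_Mapping.lookup p t) *
        (\<Prod>i\<in>Poly_Mapping.keys t. f i ^ Poly_Mapping.lookup t i) =
        Poly_Mapping.single (\<phi> t) (Poly_Mapping.lookup p t)"
      by (simp add: const_def monomial_poly_def mult_single)
  qed simp
  thus ?thesis
    by (simp add: lookup_sum lookup_single when_def sum.If_cases Int_def)
qed

section \<open>Groebner bases of kernels of monomial maps\<close>

text \<open>Only generators need comparing: those of \<open>G\<close> are among those of
  \<open>I\<close>, and by \<open>dvd\<close> those of \<open>I\<close> are monomial multiples of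
  those of \<open>G\<close>. The assumption \<open>keys\<close> places generators and cofactors in
  the ring over \<open>V\<close>.\<close>

lemma initial_ideal_eqI:
  fixes G I :: "('v, 'a::comm_ring_1) polynomial set"
  assumes "G \<subseteq> I"
    and keys: "\<And>p. p \<in> I - {0} \<Longrightarrow> Poly_Mapping.keys (lead_monomial ord p) \<subseteq> V"
    and dvd: "\<And>p. p \<in> I - {0} \<Longrightarrow>
      \<exists>g \<in> G - {0}. \<exists>t. lead_monomial ord p = lead_monomial ord g + t"
  shows "initial_ideal V ord G = initial_ideal V ord I"
proof
  interpret R: cring "polynomial_ring V :: ('v, 'a) polynomial ring" by (rule cring_polynomial_ring)
  let ?lm = "\<lambda>p. monomial_poly (lead_monomial ord p) :: ('v, 'a) polynomial"
  have I: "?lm ` (I - {0}) \<subseteq> carrier (polynomial_ring V)"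
    using keys by (auto intro!: monomial_poly_carrier)
  have GI: "?lm ` (G - {0}) \<subseteq> ?lm ` (I - {0})" using assms(1) by blast
  show "initial_ideal V ord G \<subseteq> initial_ideal V ord I"
    unfolding initial_ideal_def
    using R.genideal_self[OF I] GI
    by (intro R.genideal_minimal R.genideal_ideal[OF I]) blast
  have G: "?lm ` (G - {0}) \<subseteq> carrier (polynomial_ring V)" using GI I by blast
  interpret J: ideal "genideal (polynomial_ring V) (?lm ` (G - {0}))" "polynomial_ring V"
    by (rule R.genideal_ideal[OF G])
  show "initial_ideal V ord I \<subseteq> initial_ideal V ord G"
    unfolding initial_ideal_def
  proof (intro R.genideal_minimal R.genideal_ideal[OF G] image_subsetI)
    fix p assume p: "p \<in> I - {0}"
    then obtain g t where g: "g \<in> G - {0}" "lead_monomial ord p = lead_monomial ord g + t"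
      using dvd by blast
    have "Poly_Mapping.keys t \<subseteq> Poly_Mapping.keys (lead_monomial ord p)"
      by (auto simp: g(2) in_keys_iff lookup_add)
    hence "monomial_poly t \<in> carrier (polynomial_ring V :: ('v, 'a) polynomial ring)"
      using keys[OF p] by (intro monomial_poly_carrier) blast
    moreover have "?lm g \<in> genideal (polynomial_ring V) (?lm ` (G - {0}))"
      using R.genideal_self[OF G] g(1) by blast
    ultimately have "?lm g \<otimes>\<^bsub>polynomial_ring V\<^esub> monomial_poly t \<in>
        genideal (polynomial_ring V) (?lm ` (G - {0}))"
      by (intro J.I_r_closed)
    thus "?lm p \<in> genideal (polynomial_ring V) (?lm ` (G - {0}))"
      by (simp add: g(2) monomial_poly_add)
  qed
qed

text \<open>No S-polynomials occur: injectivity of \<open>\<phi>\<close> on normal monomials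
  (\<open>inj\<close>) takes the place of Buchberger's criterion, and \<open>reduced\<close> yields
  minimality. In each pair of \<open>B\<close> the leading monomial comes first.\<close>

lemma toric_minimal_groebner_basis:
  fixes f :: "nat \<Rightarrow> ('w, 'a::comm_ring_1) polynomial"
    and \<phi> :: "nat monomial \<Rightarrow> 'w monomial"
    and B :: "(nat monomial \<times> nat monomial) set"
  assumes "finite V" "finite B"
    and subst: "\<And>t. Poly_Mapping.keys t \<subseteq> V \<Longrightarrow>
      poly_subst f (monomial_poly t) = monomial_poly (\<phi> t)"
    and \<phi>_add: "\<And>s t. \<phi> (s + t) = \<phi> s + \<phi> t"
    and B: "\<And>l b. (l, b) \<in> B \<Longrightarrow> Poly_Mapping.keys l \<subseteq> V \<and> Poly_Mapping.keys b \<subseteq> V \<and>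
      degrevlex b l \<and> \<phi> b = \<phi> l"
    and inj: "\<And>s t. Poly_Mapping.keys s \<subseteq> V \<Longrightarrow> Poly_Mapping.keys t \<subseteq> V \<Longrightarrow>
      \<forall>l b u. (l, b) \<in> B \<longrightarrow> s \<noteq> l + u \<Longrightarrow> \<forall>l b u. (l, b) \<in> B \<longrightarrow> t \<noteq> l + u \<Longrightarrow>
      \<phi> s = \<phi> t \<Longrightarrow> s = t"
    and reduced: "\<And>l b l' b' u. (l, b) \<in> B \<Longrightarrow> (l', b') \<in> B \<Longrightarrow> l' = l + u \<Longrightarrow>
      (l, b) = (l', b')"
  shows "minimal_groebner_basis V degrevlex
    (a_kernel (polynomial_ring V) (polynomial_ring UNIV) (poly_subst f))
    ((\<lambda>(l, b). monomial_poly l - monomial_poly b) ` B)"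
proof -
  define I where "I = a_kernel (polynomial_ring V) (polynomial_ring UNIV) (poly_subst f)"
  define G :: "(nat, 'a) polynomial set"
    where "G = (\<lambda>(l, b). monomial_poly l - monomial_poly b) ` B"
  have mem_I: "p \<in> I \<longleftrightarrow>
      (\<forall>t \<in> Poly_Mapping.keys p. Poly_Mapping.keys t \<subseteq> V) \<and> poly_subst f p = 0" for p
    by (simp add: I_def a_kernel_def' carrier_polynomial_ring)
  have coeff: "Poly_Mapping.lookup (poly_subst f p) w =
      (\<Sum>t | t \<in> Poly_Mapping.keys p \<and> \<phi> t = w. Poly_Mapping.lookup p t)"
    if "\<forall>t \<in> Poly_Mapping.keys p. Poly_Mapping.keys t \<subseteq> V" for p w
    by (rule lookup_poly_subst) (use that subst in simp)
  have G_lead: "lead_monomial degrevlex (monomial_poly l - monomial_poly b :: (nat, 'a) polynomial) = l"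
    "lead_coefficient degrevlex (monomial_poly l - monomial_poly b :: (nat, 'a) polynomial) = 1"
    if "(l, b) \<in> B" for l b
    using B[OF that] by (simp_all add: lead_monomial_binomial lead_coefficient_binomial)
  have G_nz: "monomial_poly l - monomial_poly b \<noteq> (0 :: (nat, 'a) polynomial)"
    if "(l, b) \<in> B" for l b
  proof
    assume "monomial_poly l - monomial_poly b = (0 :: (nat, 'a) polynomial)"
    \<comment> \<open>Every coefficient of \<open>0\<close> is \<open>0\<close>, so it does not
      matter which monomial \<open>THE\<close> picks.\<close>
    with G_lead(2)[OF that] show False by (simp add: lead_coefficient_def)
  qed
  have "monomial_poly l - monomial_poly b \<in> I" if "(l, b) \<in> B" for l b
  proof -
    let ?p = "monomial_poly l - monomial_poly b :: (nat, 'a) polynomial"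
    have "Poly_Mapping.keys ?p \<subseteq> {l, b}"
      by (auto simp: monomial_poly_def in_keys_iff lookup_minus lookup_single when_def
          split: if_splits)
    hence "\<forall>t \<in> Poly_Mapping.keys ?p. Poly_Mapping.keys t \<subseteq> V"
      using B[OF that] by blast
    moreover have "poly_subst f ?p = 0"
    proof -
      have "poly_subst f ?p + poly_subst f (monomial_poly b) = poly_subst f (monomial_poly l)"
        by (simp add: poly_subst_add[symmetric])
      thus ?thesis using B[OF that] by (simp add: subst)
    qed
    ultimately show ?thesis by (simp add: mem_I)
  qed
  hence GI: "G \<subseteq> I" by (auto simp: G_def)
  have lower: "\<exists>s. Poly_Mapping.keys s \<subseteq> V \<and> \<phi> s = \<phi> t \<and> (s = t \<or> degrevlex s t) \<and>
      (\<forall>l b u. (l, b) \<in> B \<longrightarrow> s \<noteq> l + u)"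
    if t: "Poly_Mapping.keys t \<subseteq> V" for t
  proof -
    \<comment> \<open>A minimal element of this finite part of the fibre replaces iterated
      rewriting: exchanging a factor \<open>l\<close> for \<open>b\<close> would produce a smaller
      element of \<open>A\<close>.\<close>
    define A where "A = {s. Poly_Mapping.keys s \<subseteq> V \<and> \<phi> s = \<phi> t \<and> (s = t \<or> degrevlex s t)}"
    have "A \<subseteq> {s. Poly_Mapping.keys s \<subseteq> V \<and> total_degree s \<le> total_degree t}"
      by (auto simp: A_def degrevlex_def)
    hence "finite A"
      using finite_monomials_bounded_degree[OF \<open>finite V\<close>] by (rule finite_subset)
    moreover have "A \<noteq> {}" using t by (auto simp: A_def)
    ultimately obtain s where s: "s \<in> A" and min: "\<forall>x\<in>A. x \<noteq> s \<longrightarrow> \<not> degrevlex x s"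
      using Finite_Set.bex_min_element[OF _ asymp_on_degrevlex transp_on_degrevlex] by blast
    have "s \<noteq> l + u" if "(l, b) \<in> B" for l b u
    proof
      assume su: "s = l + u"
      have less: "degrevlex (b + u) s"
        unfolding su using B[OF that] by (intro degrevlex_add_right) simp
      have "Poly_Mapping.keys u \<subseteq> Poly_Mapping.keys s"
        by (auto simp: su in_keys_iff lookup_add)
      hence "Poly_Mapping.keys (b + u) \<subseteq> V"
        using s B[OF that] Poly_Mapping.keys_add[of b u] unfolding A_def by blast
      moreover have "\<phi> (b + u) = \<phi> t"
        using s B[OF that] by (simp add: A_def su \<phi>_add)
      moreover have "degrevlex (b + u) t"
        using less s degrevlex_trans[of "b + u" s t] by (auto simp: A_def)
      ultimately have "b + u \<in> A" by (simp add: A_def)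
      with min less show False using degrevlex_irrefl[of s] by metis
    qed
    thus ?thesis using s unfolding A_def by blast
  qed
  have lead: "\<exists>l b u. (l, b) \<in> B \<and> lead_monomial degrevlex p = l + u" if p: "p \<in> I" "p \<noteq> 0" for p
  proof (rule ccontr)
    define t where "t = lead_monomial degrevlex p"
    assume "\<nexists>l b u. (l, b) \<in> B \<and> lead_monomial degrevlex p = l + u"
    hence normal: "\<forall>l b u. (l, b) \<in> B \<longrightarrow> t \<noteq> l + u"
      unfolding t_def by blast
    have V: "Poly_Mapping.keys s \<subseteq> V" if "s \<in> Poly_Mapping.keys p" for s
      using p(1) that by (simp add: mem_I)
    have tp: "t \<in> Poly_Mapping.keys p"
      unfolding t_def using p(2) by (rule lead_monomial_greatest)
    \<comment> \<open>The normal form of \<open>s\<close> has the same image as the normal monomial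
      \<open>t\<close>, hence equals \<open>t\<close>; but it is at most \<open>s\<close>, which is
      smaller than \<open>t\<close>.\<close>
    have "s = t" if s: "s \<in> Poly_Mapping.keys p" "\<phi> s = \<phi> t" for s
    proof (rule ccontr)
      assume "s \<noteq> t"
      hence st: "degrevlex s t"
        unfolding t_def using p(2) s(1) by (intro lead_monomial_greatest(2)) simp_all
      obtain s' where s': "Poly_Mapping.keys s' \<subseteq> V" "\<phi> s' = \<phi> s" "s' = s \<or> degrevlex s' s"
        and n': "\<forall>l b u. (l, b) \<in> B \<longrightarrow> s' \<noteq> l + u"
        using lower[OF V[OF s(1)]] by blast
      have "s' = t"
        using s'(2) s(2) by (intro inj[OF s'(1) V[OF tp] n' normal]) simp
      with s'(3) st show False
        using degrevlex_irrefl[of t] degrevlex_trans[of t s t] by blast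
    qed
    \<comment> \<open>The fibre sum is now the single coefficient of \<open>t\<close>, which is
      nonzero, while the kernel condition makes the sum vanish.\<close>
    hence "{s. s \<in> Poly_Mapping.keys p \<and> \<phi> s = \<phi> t} = {t}" using tp by blast
    moreover have "(\<Sum>s | s \<in> Poly_Mapping.keys p \<and> \<phi> s = \<phi> t. Poly_Mapping.lookup p s) = 0"
      using coeff[of p "\<phi> t"] p(1) by (simp add: mem_I)
    ultimately show False using tp by (simp add: in_keys_iff)
  qed
  have "initial_ideal V degrevlex G = initial_ideal V degrevlex I"
  proof (rule initial_ideal_eqI[OF GI])
    fix p assume "p \<in> I - {0}"
    hence p: "p \<in> I" "p \<noteq> 0" by simp_all
    show "Poly_Mapping.keys (lead_monomial degrevlex p) \<subseteq> V"
      using p(1) lead_monomial_greatest(1)[OF p(2)] by (simp add: mem_I)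
    obtain l b u where l: "(l, b) \<in> B" "lead_monomial degrevlex p = l + u"
      using lead[OF p] by blast
    show "\<exists>g \<in> G - {0}. \<exists>t. lead_monomial degrevlex p = lead_monomial degrevlex g + t"
    proof (intro bexI exI)
      show "monomial_poly l - monomial_poly b \<in> G - {0}"
        using l(1) G_nz[OF l(1)] by (auto simp: G_def)
      show "lead_monomial degrevlex p =
          lead_monomial degrevlex (monomial_poly l - monomial_poly b :: (nat, 'a) polynomial) + u"
        by (simp add: G_lead(1)[OF l(1)] l(2))
    qed
  qed
  hence "groebner_basis V degrevlex I G"
    using GI \<open>finite B\<close> by (simp add: groebner_basis_def G_def)
  moreover have "lead_coefficient degrevlex g = 1" if "g \<in> G" for g
    using that G_lead(2) by (auto simp: G_def)
  moreover have "\<nexists>t. lead_monomial degrevlex h = lead_monomial degrevlex g + t"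
    if gh: "g \<in> G" "h \<in> G" "g \<noteq> h" for g h
  proof -
    obtain l b where g: "g = monomial_poly l - monomial_poly b" "(l, b) \<in> B"
      using gh(1) by (auto simp: G_def)
    obtain l' b' where h: "h = monomial_poly l' - monomial_poly b'" "(l', b') \<in> B"
      using gh(2) by (auto simp: G_def)
    show ?thesis
      using reduced[OF g(2) h(2)] gh(3) G_lead(1)[OF g(2)] G_lead(1)[OF h(2)]
      unfolding g(1) h(1) by auto
  qed
  ultimately show ?thesis
    unfolding minimal_groebner_basis_def G_def I_def by blast
qed

section \<open>Arithmetic of the exponents of normal monomials\<close>

text \<open>In the following two lemmas \<open>(a, e, b)\<close> are the exponents of a monomial outside the initial
  ideal, encoded as in \<open>normal_monomialE\<close> below, and \<open>N = n - 1\<close>. Its \<open>u\<close>-exponent is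
  \<open>(a + \<epsilon> + b) m\<^sub>1 + d (e + b N)\<close>; since \<open>gcd(m\<^sub>1, d) = 1\<close>, two such monomials with equal image
  differ by \<open>(d l, - m\<^sub>1 l)\<close> in the two coefficients, and the bound on \<open>a\<close> forces \<open>l = 0\<close>.\<close>

lemma no_relation:
  fixes N q r d l a b e a' b' e' \<epsilon> \<epsilon>' :: int
  assumes "1 \<le> r" "r \<le> N" "0 \<le> q" "1 \<le> d" "1 \<le> l" "0 \<le> a"
    and e: "0 \<le> e" "e < N" "0 \<le> e'" "e' < N"
    and \<epsilon>: "\<epsilon> = (if e = 0 then 0 else 1)" "\<epsilon>' = (if e' = 0 then 0 else 1)"
    and a': "a' < q + d \<or> a' = q + d \<and> (e' = 0 \<or> e' > N - r)"
    and A: "a' + \<epsilon>' + b' = a + \<epsilon> + b + d * l"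
    and B: "e + b * N = e' + b' * N + (q * N + r) * l"
  shows False
proof -
  \<comment> \<open>\<open>w\<close> collects the multiples of \<open>N\<close> in \<open>B\<close>.
    What remains, \<open>r * l + e' - e\<close>, exceeds \<open>- N\<close>, so \<open>w\<close> is
    nonnegative.\<close>
  define w where "w = b - b' - q * l"
  have w: "w * N = r * l + e' - e"
    using B by (simp add: w_def algebra_simps)
  have rl: "r \<le> r * l" using assms(1,5) by simp
  have "w > -1"
  proof (rule ccontr)
    assume "\<not> w > -1"
    hence "w * N \<le> (-1) * N" using e by (intro mult_right_mono) auto
    thus False using w rl e assms(1) by linarith
  qed
  hence "w \<ge> 0" by simp
  have "(q + d) * 1 \<le> (q + d) * l" using assms(3,4,5) by (intro mult_left_mono) auto
  moreover have "a' = a + w + (q + d) * l + \<epsilon> - \<epsilon>'"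
    using A by (simp add: w_def algebra_simps)
  ultimately have ge: "a' \<ge> a + w + (q + d) + \<epsilon> - \<epsilon>'"
    and eq: "a' = a + w + (q + d) * l + \<epsilon> - \<epsilon>'" by simp_all
  \<comment> \<open>If \<open>\<epsilon>\<close> vanishes, so does \<open>e\<close>, and then
    \<open>w * N\<close> is at least \<open>r\<close>, hence positive.\<close>
  have w\<epsilon>: "w + \<epsilon> \<ge> 1"
  proof (cases "e = 0")
    case True
    have "w * N > 0" using w rl e(3) assms(1) True by linarith
    hence "w \<noteq> 0" by auto
    thus ?thesis using \<open>w \<ge> 0\<close> \<epsilon> True by simp
  qed (use \<epsilon> \<open>w \<ge> 0\<close> in simp)
  \<comment> \<open>Now \<open>a'\<close> is at least \<open>q + d + 1 - \<epsilon>'\<close>, and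
    its upper bound leaves only equality, with \<open>\<epsilon>' = 1\<close>.\<close>
  hence "e' \<noteq> 0" "a' = q + d" "w + \<epsilon> = 1"
    using ge a' \<epsilon> assms(6) by (auto split: if_splits)
  hence e'': "e' > N - r" using a' by auto
  \<comment> \<open>In both cases \<open>e + w * N = r * l + e'\<close> exceeds \<open>N\<close>,
    whereas the left side is \<open>N\<close> for \<open>e = 0\<close> and \<open>e\<close>, which
    is less than \<open>N\<close>, otherwise.\<close>
  show False
  proof (cases "e = 0")
    case True
    hence "w = 1" using \<epsilon> \<open>w + \<epsilon> = 1\<close> by simp
    thus False using w rl e'' True by simp
  next
    case False
    hence "w = 0" using \<epsilon> \<open>w + \<epsilon> = 1\<close> by simp
    thus False using w rl e'' e by simp
  qed
qed

lemma exponents_unique: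
  fixes N q r d m a b e a' b' e' \<epsilon> \<epsilon>' :: int
  assumes "1 \<le> r" "r \<le> N" "0 \<le> q" "1 \<le> d" "m = q * N + r" "coprime m d" "0 \<le> a" "0 \<le> a'"
    and e: "0 \<le> e" "e < N" "0 \<le> e'" "e' < N"
    and \<epsilon>: "\<epsilon> = (if e = 0 then 0 else 1)" "\<epsilon>' = (if e' = 0 then 0 else 1)"
    and a: "a < q + d \<or> a = q + d \<and> (e = 0 \<or> e > N - r)"
    and a': "a' < q + d \<or> a' = q + d \<and> (e' = 0 \<or> e' > N - r)"
    and eq: "(a + \<epsilon> + b) * m + d * (e + b * N) = (a' + \<epsilon>' + b') * m + d * (e' + b' * N)"
  shows "a = a' \<and> b = b' \<and> e = e'"
proof -
  have "d dvd ((a' + \<epsilon>' + b') - (a + \<epsilon> + b)) * m"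
  proof
    show "((a' + \<epsilon>' + b') - (a + \<epsilon> + b)) * m = d * ((e + b * N) - (e' + b' * N))"
      using eq by (simp add: algebra_simps)
  qed
  hence "d dvd (a' + \<epsilon>' + b') - (a + \<epsilon> + b)"
    using assms(6) by (simp add: coprime_dvd_mult_left_iff coprime_commute)
  then obtain l where l: "(a' + \<epsilon>' + b') - (a + \<epsilon> + b) = d * l" by blast
  have "d * ((e + b * N) - (e' + b' * N)) = ((a' + \<epsilon>' + b') - (a + \<epsilon> + b)) * m"
    using eq by (simp add: algebra_simps)
  also have "\<dots> = d * (m * l)" unfolding l by simp
  finally have "d * ((e + b * N) - (e' + b' * N)) = d * (m * l)" .
  hence B: "(e + b * N) - (e' + b' * N) = m * l" using assms(4) by simp
  \<comment> \<open>The situation is symmetric: exchanging the two monomials replaces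
    \<open>l\<close> by \<open>- l\<close>.\<close>
  have "\<not> l \<ge> 1"
    using no_relation[of r N q d l a e e' \<epsilon> \<epsilon>' a' b' b] assms l B by (auto simp: algebra_simps)
  moreover have "\<not> - l \<ge> 1"
    using no_relation[of r N q d "- l" a' e' e \<epsilon>' \<epsilon> a b b'] assms l B by (auto simp: algebra_simps)
  ultimately have "l = 0" by linarith
  with B have "e + b * N = e' + b' * N" by simp
  \<comment> \<open>As \<open>e\<close> and \<open>e'\<close> lie in the range from 0 to
    \<open>N - 1\<close>, they are the remainders modulo \<open>N\<close>.\<close>
  moreover from this have "(e + b * N) mod N = (e' + b' * N) mod N" by simp
  hence "e = e'" using e by simp
  ultimately have "b = b'" using e by simp
  with l \<open>e = e'\<close> \<open>l = 0\<close> \<epsilon> show ?thesis by simp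
qed

section \<open>The parametrization on exponent vectors\<close>

text \<open>Summing over the fixed index range instead of \<open>keys t\<close> makes additivity a
  termwise fact. Variables outside the range are ignored, so agreement with
  \<open>poly_subst\<close> holds for monomials supported in it.\<close>

definition curve_monomial :: "nat \<Rightarrow> (nat \<Rightarrow> nat) \<Rightarrow> nat monomial \<Rightarrow> param monomial" where
  "curve_monomial n m t = (\<Sum>i\<in>{1..n + 1}.
     Poly_Mapping.single Par_u ((if i = n + 1 then 0 else m i) * Poly_Mapping.lookup t i) +
     Poly_Mapping.single Par_v ((if i = n + 1 then m n else m n - m i) * Poly_Mapping.lookup t i))"

lemma curve_monomial_add: "curve_monomial n m (s + t) = curve_monomial n m s + curve_monomial n m t"
proof -
  have "curve_monomial n m (s + t) = (\<Sum>i\<in>{1..n + 1}.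
     (Poly_Mapping.single Par_u ((if i = n + 1 then 0 else m i) * Poly_Mapping.lookup s i) +
     Poly_Mapping.single Par_v ((if i = n + 1 then m n else m n - m i) * Poly_Mapping.lookup s i)) +
     (Poly_Mapping.single Par_u ((if i = n + 1 then 0 else m i) * Poly_Mapping.lookup t i) +
     Poly_Mapping.single Par_v ((if i = n + 1 then m n else m n - m i) * Poly_Mapping.lookup t i)))"
    unfolding curve_monomial_def
    by (intro sum.cong refl) (simp only: lookup_add distrib_left single_add add_ac)
  thus ?thesis by (simp only: curve_monomial_def sum.distrib)
qed

lemma curve_monomial_single:
  assumes "i \<in> {1..n + 1}"
  shows "curve_monomial n m (Poly_Mapping.single i a) =
     Poly_Mapping.single Par_u ((if i = n + 1 then 0 else m i) * a) +
     Poly_Mapping.single Par_v ((if i = n + 1 then m n else m n - m i) * a)"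
proof -
  have "curve_monomial n m (Poly_Mapping.single i a) = (\<Sum>j\<in>{i}.
     Poly_Mapping.single Par_u
       ((if j = n + 1 then 0 else m j) * Poly_Mapping.lookup (Poly_Mapping.single i a) j) +
     Poly_Mapping.single Par_v
       ((if j = n + 1 then m n else m n - m j) * Poly_Mapping.lookup (Poly_Mapping.single i a) j))"
    unfolding curve_monomial_def
    by (rule sum.mono_neutral_right) (use assms in \<open>auto simp: lookup_single\<close>)
  thus ?thesis by simp
qed

lemma poly_subst_curve_param:
  assumes "Poly_Mapping.keys t \<subseteq> {1..n + 1}"
  shows "poly_subst (curve_param n m) (monomial_poly t) =
    (monomial_poly (curve_monomial n m t) :: (param, 'a::comm_ring_1) polynomial)"
proof -
  let ?f = "curve_param n m :: nat \<Rightarrow> (param, 'a) polynomial"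
  have "poly_subst ?f (monomial_poly t) =
      (\<Prod>i\<in>Poly_Mapping.keys t. ?f i ^ Poly_Mapping.lookup t i)"
    by (simp add: monomial_poly_def poly_subst_single const_def)
  also have "\<dots> = (\<Prod>i\<in>{1..n + 1}. ?f i ^ Poly_Mapping.lookup t i)"
    by (rule prod.mono_neutral_left) (use assms in \<open>auto simp: in_keys_iff\<close>)
  also have "\<dots> = monomial_poly (curve_monomial n m t)"
    unfolding curve_monomial_def monomial_poly_sum
    by (intro prod.cong refl)
      (simp add: curve_param_def monomial_poly_add var_power[symmetric] power_mult power_mult_distrib)
  finally show ?thesis .
qed

lemma monomial_eq_add_minus:
  fixes l t :: "'v monomial"
  assumes "\<And>i. Poly_Mapping.lookup l i \<le> Poly_Mapping.lookup t i"
  shows "t = l + (t - l)"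
  by (rule poly_mapping_eqI) (use assms in \<open>simp add: lookup_add lookup_minus\<close>)

lemma param_monomial_eq:
  "Poly_Mapping.single Par_u a + Poly_Mapping.single Par_v b =
    Poly_Mapping.single Par_u a' + Poly_Mapping.single Par_v b' \<longleftrightarrow> a = a' \<and> b = b'"
  for a b a' b' :: nat
proof
  let ?s = "\<lambda>a b. Poly_Mapping.single Par_u a + Poly_Mapping.single Par_v b"
  assume "?s a b = ?s a' b'"
  hence "Poly_Mapping.lookup (?s a b) p = Poly_Mapping.lookup (?s a' b') p" for p by simp
  from this[of Par_u] this[of Par_v] show "a = a' \<and> b = b'"
    by (simp add: lookup_add lookup_single)
qed simp

lemma param_monomial_add:
  "(Poly_Mapping.single Par_u a + Poly_Mapping.single Par_v b) +
    (Poly_Mapping.single Par_u a' + Poly_Mapping.single Par_v b') =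
    Poly_Mapping.single Par_u (a + a') + Poly_Mapping.single Par_v (b + b')"
  for a b a' b' :: nat
  by (simp only: single_add ac_simps)

section \<open>The binomials for an arithmetic sequence\<close>

locale arithmetic_curve =
  fixes n d q r :: nat and m :: "nat \<Rightarrow> nat"
  assumes n: "n \<ge> 2" and m1: "m 1 > 0" and d: "d > 0"
    and m: "\<And>i. i \<in> {1..n} \<Longrightarrow> m i = m 1 + (i - 1) * d"
    and coprime: "coprime (m 1) d"
    and r: "1 \<le> r" "r \<le> n - 1"
    and m1_eq: "m 1 = q * (n - 1) + r"
begin

abbreviation "x \<equiv> Poly_Mapping.single :: nat \<Rightarrow> nat \<Rightarrow> nat monomial"

definition quadric :: "nat \<Rightarrow> nat \<Rightarrow> nat monomial \<times> nat monomial" where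
  "quadric i j = (x i 1 + x j 1, x (i - 1) 1 + x (j + 1) 1)"

text \<open>The index \<open>r + i\<close> is the \<open>n - k + i\<close> of the theorem, since
  \<open>k = n - r\<close>.\<close>

definition cap :: "nat \<Rightarrow> nat monomial \<times> nat monomial" where
  "cap i = (x 1 (q + d) + x i 1, x (r + i) 1 + x n q + x (n + 1) d)"

definition binomials :: "(nat monomial \<times> nat monomial) set" where
  "binomials = {quadric i j | i j. 2 \<le> i \<and> i \<le> j \<and> j \<le> n - 1} \<union> {cap i | i. 1 \<le> i \<and> i \<le> n - r}"

lemma binomials_cases [consumes 1, case_names quadric cap]:
  assumes "(l, b) \<in> binomials"
  obtains i j where "2 \<le> i" "i \<le> j" "j \<le> n - 1" "l = x i 1 + x j 1"
      "b = x (i - 1) 1 + x (j + 1) 1"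
  | i where "1 \<le> i" "i \<le> n - r" "l = x 1 (q + d) + x i 1" "b = x (r + i) 1 + x n q + x (n + 1) d"
  using assms by (auto simp: binomials_def quadric_def cap_def)

lemma finite_binomials: "finite binomials"
proof (rule finite_subset)
  show "binomials \<subseteq> case_prod quadric ` ({..n} \<times> {..n}) \<union> cap ` {..n}"
  proof
    fix g assume "g \<in> binomials"
    then consider i j where "g = quadric i j" "i \<le> n" "j \<le> n" | i where "g = cap i" "i \<le> n"
      unfolding binomials_def by force
    thus "g \<in> case_prod quadric ` ({..n} \<times> {..n}) \<union> cap ` {..n}"
      by cases force+
  qed
qed simp

lemma curve_monomial_x:
  assumes "1 \<le> i" "i \<le> n"
  shows "curve_monomial n m (x i a) =
    Poly_Mapping.single Par_u ((m 1 + (i - 1) * d) * a) + Poly_Mapping.single Par_v ((n - i) * d * a)"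
proof -
  have "m n - m i = (n - i) * d"
    using m[of i] m[of n] n assms by (simp add: diff_mult_distrib[symmetric])
  thus ?thesis using m[of i] assms by (simp add: curve_monomial_single)
qed

lemma curve_monomial_x_last:
  "curve_monomial n m (x (n + 1) a) =
    Poly_Mapping.single Par_u 0 + Poly_Mapping.single Par_v ((m 1 + (n - 1) * d) * a)"
  using m[of n] n by (simp add: curve_monomial_single)

lemma keys_binomials:
  assumes "(l, b) \<in> binomials"
  shows "Poly_Mapping.keys l \<subseteq> {1..n + 1}" "Poly_Mapping.keys b \<subseteq> {1..n + 1}"
  using assms n r
  by (cases rule: binomials_cases;
      auto simp: in_keys_iff lookup_add lookup_single when_def split: if_splits)+

text \<open>Both types are homogeneous, so the last differing index decides: \<open>j + 1\<close>
  for a quadric, as \<open>i \<le> j\<close>, and \<open>n + 1\<close> for the other type, as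
  \<open>d > 0\<close>. That variable occurs only in \<open>b\<close>.\<close>

lemma degrevlex_binomials:
  assumes "(l, b) \<in> binomials"
  shows "degrevlex b l"
  using assms
proof (cases rule: binomials_cases)
  case (quadric i j)
  show ?thesis
    unfolding degrevlex_def
    by (intro disjI2 conjI exI[of _ "j + 1"])
      (use quadric in \<open>auto simp: total_degree_add total_degree_single lookup_add lookup_single when_def\<close>)
next
  case (cap i)
  show ?thesis
    unfolding degrevlex_def
    by (intro disjI2 conjI exI[of _ "n + 1"])
      (use cap n d r in \<open>auto simp: total_degree_add total_degree_single lookup_add lookup_single when_def\<close>)
qed

text \<open>Quadrics preserve the sum of the indices, and exponents are affine in the index. For
  \<open>cap\<close>, trading \<open>x_1^q x_i\<close> for \<open>x_n^q x_(r+i)\<close> moves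
  \<open>(q * (n - 1) + r) * d = m 1 * d\<close> from the exponent of \<open>v\<close> to that of
  \<open>u\<close>; trading \<open>x_1^d\<close> for \<open>x_(n+1)^d\<close> moves the same amount
  back.\<close>

lemma curve_monomial_binomials:
  assumes "(l, b) \<in> binomials"
  shows "curve_monomial n m b = curve_monomial n m l"
  using assms
proof (cases rule: binomials_cases)
  case (quadric i j)
  have "(i - 1 - 1) * d + (j + 1 - 1) * d = (i - 1) * d + (j - 1) * d"
    "(n - (i - 1)) * d + (n - (j + 1)) * d = (n - i) * d + (n - j) * d"
    unfolding add_mult_distrib[symmetric] using quadric(1-3) by simp_all
  hence "m 1 + (i - 1 - 1) * d + (m 1 + (j + 1 - 1) * d) = m 1 + (i - 1) * d + (m 1 + (j - 1) * d)"
    "(n - (i - 1)) * d + (n - (j + 1)) * d = (n - i) * d + (n - j) * d"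
    by simp_all
  moreover have "1 \<le> i - 1" "i - 1 \<le> n" "1 \<le> i" "i \<le> n" "1 \<le> j" "j \<le> n" "1 \<le> j + 1" "j + 1 \<le> n"
    using quadric(1-3) by simp_all
  ultimately show ?thesis
    unfolding quadric(4,5) curve_monomial_add
    by (simp only: curve_monomial_x param_monomial_add param_monomial_eq mult_1_right)
next
  case (cap i)
  have i: "1 \<le> i" "i \<le> n" "1 \<le> r + i" "r + i \<le> n" "1 \<le> (1::nat)" "1 \<le> n" "n \<le> n"
    using cap n r by simp_all
  define N where "N = n - 1"
  have md: "m 1 * d = q * N * d + r * d"
    unfolding N_def by (subst m1_eq) (simp only: add_mult_distrib)
  have "(r + i - 1) * d = r * d + (i - 1) * d"
    unfolding add_mult_distrib[symmetric] using cap(1) by simp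
  with md have "(m 1 + (r + i - 1) * d) * 1 + (m 1 + N * d) * q + 0 =
      (m 1 + (1 - 1) * d) * (q + d) + (m 1 + (i - 1) * d) * 1"
    by (simp add: algebra_simps)
  moreover have "(n - i) * d = (n - (r + i)) * d + r * d"
    unfolding add_mult_distrib[symmetric] using i(4) by simp
  with md have "(n - (r + i)) * d * 1 + (n - n) * d * q + (m 1 + N * d) * d =
      N * d * (q + d) + (n - i) * d * 1"
    by (simp add: algebra_simps)
  ultimately show ?thesis
    unfolding cap(3,4) curve_monomial_add
    by (simp only: i curve_monomial_x curve_monomial_x_last param_monomial_add param_monomial_eq
        N_def[symmetric])
qed

text \<open>Within a type, divisibility forces equal indices. Across types, \<open>x_1\<close>
  divides only the leading monomials of \<open>cap\<close>, while those of quadrics have degree two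
  in \<open>x_2, ..., x_(n-1)\<close>, where \<open>cap\<close> reaches at most one.\<close>

lemma binomials_reduced:
  assumes "(l, b) \<in> binomials" "(l', b') \<in> binomials" "l' = l + u"
  shows "(l, b) = (l', b')"
proof -
  have le: "Poly_Mapping.lookup l v \<le> Poly_Mapping.lookup l' v" for v
    by (simp add: assms(3) lookup_add)
  note simps = lookup_add lookup_single when_def
  show ?thesis
    using assms(1)
  proof (cases rule: binomials_cases)
    case l: (quadric i j)
    show ?thesis
      using assms(2)
    proof (cases rule: binomials_cases)
      case l': (quadric i' j')
      have "i = i' \<and> j = j'"
        using le[of i] le[of j] l(1,2) l'(1,2) by (auto simp: l(4) l'(4) simps split: if_splits)
      thus ?thesis using l(4,5) l'(4,5) by simp
    next
      case l': (cap i')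
      show ?thesis
        using le[of i] le[of j] l(1,2) by (auto simp: l(4) l'(3) simps split: if_splits)
    qed
  next
    case l: (cap i)
    show ?thesis
      using assms(2)
    proof (cases rule: binomials_cases)
      case l': (quadric i' j')
      show ?thesis
        using le[of 1] l'(1,2) d by (auto simp: l(3) l'(4) simps split: if_splits)
    next
      case l': (cap i')
      have "i = i'"
        using le[of i] l(1) by (auto simp: l(3) l'(3) simps split: if_splits)
      thus ?thesis using l(3,4) l'(3,4) by simp
    qed
  qed
qed

section \<open>Normal monomials and injectivity on them\<close>

text \<open>The value \<open>e = 0\<close> encodes that none of the variables \<open>x\<^sub>2, \<dots>, x\<^sub>n\<^sub>-\<^sub>1\<close> occurs,
  and \<open>e > 0\<close> that the only one is \<open>x\<^sub>e\<^sub>+\<^sub>1\<close>.\<close>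

lemma normal_monomialE:
  assumes t: "Poly_Mapping.keys t \<subseteq> {1..n + 1}"
    and normal: "\<forall>l b u. (l, b) \<in> binomials \<longrightarrow> t \<noteq> l + u"
  obtains a b c e where "e < n - 1"
    "t = x 1 a + (if e = 0 then 0 else x (e + 1) 1) + x n b + x (n + 1) c"
    "a < q + d \<or> a = q + d \<and> (e = 0 \<or> e > n - 1 - r)"
proof -
  let ?t = "Poly_Mapping.lookup t"
  have not_le: "\<exists>v. Poly_Mapping.lookup l v > ?t v" if "(l, b) \<in> binomials" for l b
  proof (rule ccontr)
    assume "\<nexists>v. Poly_Mapping.lookup l v > ?t v"
    hence "t = l + (t - l)" by (intro monomial_eq_add_minus) (simp add: not_less)
    thus False using normal that by blast
  qed
  have quad: "\<exists>v. Poly_Mapping.lookup (x i 1 + x j 1) v > ?t v"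
    if "2 \<le> i" "i \<le> j" "j \<le> n - 1" for i j
    by (rule not_le[of _ "x (i - 1) 1 + x (j + 1) 1"])
      (use that in \<open>auto simp: binomials_def quadric_def\<close>)
  have cap: "\<exists>v. Poly_Mapping.lookup (x 1 (q + d) + x i 1) v > ?t v"
    if "1 \<le> i" "i \<le> n - r" for i
    by (rule not_le[of _ "x (r + i) 1 + x n q + x (n + 1) d"])
      (use that in \<open>auto simp: binomials_def cap_def\<close>)
  note simps = lookup_add lookup_single when_def
  have outside: "?t v = 0" if "v \<notin> {1..n + 1}" for v
    using t that by (auto simp: in_keys_iff)
  have a: "?t 1 \<le> q + d"
  proof -
    have "1 \<le> n - r" using r n by simp
    \<comment> \<open>For \<open>i = 1\<close> the leading monomial is the pure power
      \<open>x_1^(q+d+1)\<close>.\<close>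
    from cap[OF order_refl this] show ?thesis by (auto simp: simps split: if_splits)
  qed
  \<comment> \<open>Quadrics with equal indices bound the inner exponents by 1; those with distinct
    indices exclude two inner variables.\<close>
  have one: "?t i \<le> 1" if "2 \<le> i" "i \<le> n - 1" for i
    using quad[of i i] that by (auto simp: simps split: if_splits)
  have two: "?t i = 0 \<or> ?t j = 0" if "2 \<le> i" "i < j" "j \<le> n - 1" for i j
    using quad[of i j] that by (auto simp: simps split: if_splits)
  show ?thesis
  proof (cases "\<exists>i. 2 \<le> i \<and> i \<le> n - 1 \<and> ?t i \<noteq> 0")
    case False
    have "t = x 1 (?t 1) + x n (?t n) + x (n + 1) (?t (n + 1))"
    proof (rule poly_mapping_eqI)
      fix v
      consider "v \<notin> {1..n + 1}" | "v = 1" | "v = n" | "v = n + 1" | "2 \<le> v" "v \<le> n - 1"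
        by force
      thus "?t v = Poly_Mapping.lookup (x 1 (?t 1) + x n (?t n) + x (n + 1) (?t (n + 1))) v"
        by cases (use n False outside in \<open>auto simp: simps\<close>)
    qed
    thus ?thesis using a n by (intro that[of 0 "?t 1" "?t n" "?t (n + 1)"]) auto
  next
    case True
    then obtain i where i: "2 \<le> i" "i \<le> n - 1" "?t i \<noteq> 0" by blast
    have ti: "?t i = 1" using one[OF i(1,2)] i(3) by simp
    have other: "?t j = 0" if "2 \<le> j" "j \<le> n - 1" "j \<noteq> i" for j
      using two[of i j] two[of j i] that i by (cases i j rule: linorder_cases) auto
    have "t = x 1 (?t 1) + x i 1 + x n (?t n) + x (n + 1) (?t (n + 1))"
    proof (rule poly_mapping_eqI)
      fix v
      consider "v \<notin> {1..n + 1}" | "v = 1" | "v = n" | "v = n + 1" | "v = i"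
        | "2 \<le> v" "v \<le> n - 1" "v \<noteq> i"
        by force
      thus "?t v = Poly_Mapping.lookup (x 1 (?t 1) + x i 1 + x n (?t n) + x (n + 1) (?t (n + 1))) v"
        by cases (use n i(1,2) ti other outside in \<open>auto simp: simps\<close>)
    qed
    \<comment> \<open>Otherwise \<open>x_1^(q+d) x_i\<close>, the leading monomial of
      \<open>cap i\<close>, divides \<open>t\<close>. With \<open>e = i - 1\<close> the alternative
      \<open>i > n - r\<close> becomes \<open>e > n - 1 - r\<close>.\<close>
    moreover have "?t 1 < q + d \<or> i > n - r"
    proof (rule ccontr)
      assume "\<not> (?t 1 < q + d \<or> i > n - r)"
      thus False using cap[of i] i ti by (auto simp: simps split: if_splits)
    qed
    ultimately show ?thesis
      using a i by (intro that[of "i - 1" "?t 1" "?t n" "?t (n + 1)"]) auto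
  qed
qed

text \<open>The exponent of \<open>u\<close> is grouped into multiples of \<open>m 1\<close> and of
  \<open>d\<close>, the form that \<open>exponents_unique\<close> takes. The last variable enters
  only the exponent of \<open>v\<close>.\<close>

lemma curve_monomial_normal:
  assumes "e < n - 1"
  shows "curve_monomial n m (x 1 a + (if e = 0 then 0 else x (e + 1) 1) + x n b + x (n + 1) c) =
    Poly_Mapping.single Par_u ((a + (if e = 0 then 0 else 1) + b) * m 1 + d * (e + b * (n - 1))) +
    Poly_Mapping.single Par_v
      ((n - 1) * d * a + (if e = 0 then 0 else (n - 1 - e) * d) + (m 1 + (n - 1) * d) * c)"
proof -
  define N where "N = n - 1"
  have "1 \<le> e + 1" "e + 1 \<le> n" "1 \<le> (1::nat)" "1 \<le> n" "n \<le> n" "n - (e + 1) = N - e"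
    using assms by (simp_all add: N_def)
  note simps = this curve_monomial_add curve_monomial_x curve_monomial_x_last
    param_monomial_add param_monomial_eq
  show ?thesis
  proof (cases "e = 0")
    case True
    thus ?thesis
      unfolding N_def[symmetric] if_P[OF True] add_0_right
      by (simp only: simps N_def[symmetric]) (simp add: algebra_simps)
  next
    case False
    thus ?thesis
      unfolding N_def[symmetric]
      by (simp only: simps if_False N_def[symmetric]) (simp add: algebra_simps)
  qed
qed

lemma curve_monomial_inj_normal:
  assumes s: "Poly_Mapping.keys s \<subseteq> {1..n + 1}"
    and t: "Poly_Mapping.keys t \<subseteq> {1..n + 1}"
    and ns: "\<forall>l b u. (l, b) \<in> binomials \<longrightarrow> s \<noteq> l + u"
    and nt: "\<forall>l b u. (l, b) \<in> binomials \<longrightarrow> t \<noteq> l + u"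
    and eq: "curve_monomial n m s = curve_monomial n m t"
  shows "s = t"
proof -
  obtain a b c e where e: "e < n - 1"
    and s_eq: "s = x 1 a + (if e = 0 then 0 else x (e + 1) 1) + x n b + x (n + 1) c"
    and a: "a < q + d \<or> a = q + d \<and> (e = 0 \<or> e > n - 1 - r)"
    by (rule normal_monomialE[OF s ns])
  obtain a' b' c' e' where e': "e' < n - 1"
    and t_eq: "t = x 1 a' + (if e' = 0 then 0 else x (e' + 1) 1) + x n b' + x (n + 1) c'"
    and a': "a' < q + d \<or> a' = q + d \<and> (e' = 0 \<or> e' > n - 1 - r)"
    by (rule normal_monomialE[OF t nt])
  define \<epsilon> \<epsilon>' :: nat where "\<epsilon> = (if e = 0 then 0 else 1)" and "\<epsilon>' = (if e' = 0 then 0 else 1)"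
  note eq' = eq[unfolded s_eq t_eq curve_monomial_normal[OF e] curve_monomial_normal[OF e']
      param_monomial_eq]
  have "(a + \<epsilon> + b) * m 1 + d * (e + b * (n - 1)) = (a' + \<epsilon>' + b') * m 1 + d * (e' + b' * (n - 1))"
    using eq' by (simp add: \<epsilon>_def \<epsilon>'_def)
  \<comment> \<open>Over the integers, since the differences between the two monomials may have
    either sign.\<close>
  hence "int ((a + \<epsilon> + b) * m 1 + d * (e + b * (n - 1))) =
      int ((a' + \<epsilon>' + b') * m 1 + d * (e' + b' * (n - 1)))"
    by (rule arg_cong)
  moreover have int_m: "int (m 1) = int q * int (n - 1) + int r"
    using m1_eq by (metis of_nat_add of_nat_mult)
  moreover have cop: "coprime (int (m 1)) (int d)"
    using coprime by simp
  ultimately have "int a = int a' \<and> int b = int b' \<and> int e = int e'"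
    using r d e e' a a'
    by (intro exponents_unique[of "int r" "int (n - 1)" "int q" "int d" "int (m 1)" "int a" "int a'"
          "int e" "int e'" "int \<epsilon>" "int \<epsilon>'", OF _ _ _ _ int_m cop])
      (auto simp: \<epsilon>_def \<epsilon>'_def)
  hence abe: "a = a'" "b = b'" "e = e'" by simp_all
  \<comment> \<open>The exponent of \<open>v\<close> now differs only in its last summand, whose
    factor is positive.\<close>
  with eq' have "(m 1 + (n - 1) * d) * c = (m 1 + (n - 1) * d) * c'"
    by (simp only: add_left_cancel)
  hence "c = c'" using m1 by simp
  with abe show ?thesis by (simp add: s_eq t_eq)
qed

end

theorem theorem2p2:
  fixes n d q r \<alpha> k :: nat
    and m :: "nat \<Rightarrow> nat"
    and \<G> :: "(nat, 'a::field) polynomial set"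
  assumes "infinite (UNIV :: 'a set)"
    and "n \<ge> 2"
    and "m 1 > 0" and "d > 0"
    and "\<forall>i \<in> {1..n}. m i = m 1 + (i - 1) * d"
    and "gcd (m 1) d = 1"
    and "r \<in> {1..n - 1}"
    and "m 1 = q * (n - 1) + r"
    and "\<alpha> = q + d"
    and "k = n - r"
    and "\<G> = {var i * var j - var (i - 1) * var (j + 1) | i j. 2 \<le> i \<and> i \<le> j \<and> j \<le> n - 1}
            \<union> {var 1 ^ \<alpha> * var i - var (n - k + i) * var n ^ q * var (n + 1) ^ d | i. 1 \<le> i \<and> i \<le> k}"
  shows "minimal_groebner_basis {1..n + 1} degrevlex (curve_ideal n m) \<G>"
proof -
  interpret arithmetic_curve n d q r m
  proof
    show "m i = m 1 + (i - 1) * d" if "i \<in> {1..n}" for i using assms(5) that by (rule bspec)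
    show "coprime (m 1) d" using assms(6) by (simp only: coprime_iff_gcd_eq_1)
    show "1 \<le> r" "r \<le> n - 1" using assms(7) by simp_all
  qed (fact assms)+
  let ?binom = "\<lambda>(l, b). monomial_poly l - monomial_poly b :: (nat, 'a) polynomial"
  have quadric: "?binom (quadric i j) = var i * var j - var (i - 1) * var (j + 1)" for i j
    by (simp only: quadric_def case_prod_conv monomial_poly_add var_def)
  have cap: "?binom (cap i) = var 1 ^ \<alpha> * var i - var (n - k + i) * var n ^ q * var (n + 1) ^ d" for i
  proof -
    \<comment> \<open>The bound \<open>r \<le> n - 1\<close> keeps the truncated subtraction
      exact.\<close>
    have "n - k = r" using assms(7,10) by auto
    thus ?thesis
      by (simp add: cap_def monomial_poly_add var_power[symmetric] assms(9))
  qed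
  \<comment> \<open>Stated for arbitrary \<open>f\<close> so that \<open>?binom\<close> stays folded
    until \<open>quadric\<close> and \<open>cap\<close> rewrite it.\<close>
  have "f ` binomials = {f (quadric i j) | i j. 2 \<le> i \<and> i \<le> j \<and> j \<le> n - 1} \<union>
      {f (cap i) | i. 1 \<le> i \<and> i \<le> n - r}" for f :: "_ \<Rightarrow> (nat, 'a) polynomial"
    unfolding binomials_def by blast
  from this[of ?binom] have G: "\<G> = ?binom ` binomials"
    unfolding quadric cap assms(10,11) by (rule sym)
  show ?thesis
    unfolding curve_ideal_def G
  proof (rule toric_minimal_groebner_basis[OF finite_atLeastAtMost finite_binomials,
        where \<phi> = "curve_monomial n m"])
    show "poly_subst (curve_param n m) (monomial_poly t) =
        (monomial_poly (curve_monomial n m t) :: (param, 'a) polynomial)"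
      if "Poly_Mapping.keys t \<subseteq> {1..n + 1}" for t
      using that by (rule poly_subst_curve_param)
    show "Poly_Mapping.keys l \<subseteq> {1..n + 1} \<and> Poly_Mapping.keys b \<subseteq> {1..n + 1} \<and>
        degrevlex b l \<and> curve_monomial n m b = curve_monomial n m l" if "(l, b) \<in> binomials" for l b
      using keys_binomials[OF that] degrevlex_binomials[OF that] curve_monomial_binomials[OF that]
      by simp
    show "s = t" if "Poly_Mapping.keys s \<subseteq> {1..n + 1}" "Poly_Mapping.keys t \<subseteq> {1..n + 1}"
      "\<forall>l b u. (l, b) \<in> binomials \<longrightarrow> s \<noteq> l + u" "\<forall>l b u. (l, b) \<in> binomials \<longrightarrow> t \<noteq> l + u"
      "curve_monomial n m s = curve_monomial n m t" for s t
      using that by (rule curve_monomial_inj_normal)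
  qed (rule curve_monomial_add, rule binomials_reduced)
qed

end
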